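(* For $\lambda>0$ let $N_\lambda,N'_\lambda$ be independent Poisson random variables with parameter $\lambda$, let $Y_\lambda=N_\lambda-N'_\lambda$, and set $$P_\lambda=P\left\{|Y_\lambda-E[Y_\lambda]|\le\sqrt{\mathrm{Var}(Y_\lambda)}\right\},\qquad P^0_\lambda=P\left\{|Y_\lambda-E[Y_\lambda]|<\sqrt{\mathrm{Var}(Y_\lambda)}\right\}.$$ Then $$\inf_{\lambda>0}P_\lambda=\inf_{\lambda>0}P^0_\lambda=P^0_{1/2}=e^{-1}\sum_{k=0}^\infty\frac{1}{2^{2k}(k!)^2}.$$ Consequently, with $\mathcal I$ the set of all infinitely divisible real random variables $X$ with $E[X^2]<\infty$ and $P_{\mathcal I}=\inf_{X\in\mathcal I}P\{|X-E[X]|\le\sqrt{\mathrm{Var}(X)}\}$, we have $P_{\mathcal I}\le e^{-1}\sum_{k=0}^\infty\frac{1}{2^{2k}(k!)^2}$.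
   Context: A real random variable is infinitely divisible if for every $n\ge1$ its distribution equals that of a sum of $n$ i.i.d. random variables. *)

theory Defs
  imports "HOL-Probability.Probability"
begin

definition skellam_pmf :: "real \<Rightarrow> int pmf" where
  "skellam_pmf lam =
     map_pmf (\<lambda>(a, b). int a - int b) (pair_pmf (poisson_pmf lam) (poisson_pmf lam))"

definition P_lam :: "real \<Rightarrow> real" where
  "P_lam lam = measure_pmf.prob (skellam_pmf lam)
     {y. \<bar>real_of_int y - measure_pmf.expectation (skellam_pmf lam) real_of_int\<bar>
          \<le> sqrt (measure_pmf.variance (skellam_pmf lam) real_of_int)}"

definition P0_lam :: "real \<Rightarrow> real" where
  "P0_lam lam = measure_pmf.prob (skellam_pmf lam)
     {y. \<bar>real_of_int y - measure_pmf.expectation (skellam_pmf lam) real_of_int\<bar>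
          < sqrt (measure_pmf.variance (skellam_pmf lam) real_of_int)}"

definition inf_divisible_distr :: "real measure \<Rightarrow> bool" where
  "inf_divisible_distr mu \<longleftrightarrow>
     (\<forall>n::nat. n \<ge> 1 \<longrightarrow>
        (\<exists>nu. prob_space nu \<and> sets nu = sets borel \<and>
             mu = distr (PiM {..<n} (\<lambda>_. nu)) borel (\<lambda>\<omega>. \<Sum>i<n. \<omega> i)))"

definition inf_divisible_rv :: "'a measure \<Rightarrow> ('a \<Rightarrow> real) \<Rightarrow> bool" where
  "inf_divisible_rv M X \<longleftrightarrow> inf_divisible_distr (distr M borel X)"

text \<open>The class I: infinitely divisible real random variables with finite second moment.
  Sample spaces are taken of type real, which realises every distribution.\<close>
definition class_I :: "(real measure \<times> (real \<Rightarrow> real)) set" where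
  "class_I = {(M, X). prob_space M \<and> X \<in> borel_measurable M \<and>
                      integrable M (\<lambda>\<omega>. (X \<omega>)\<^sup>2) \<and> inf_divisible_rv M X}"

definition P_I :: real where
  "P_I = (INF (M, X) \<in> class_I.
            measure M {\<omega> \<in> space M. \<bar>X \<omega> - prob_space.expectation M X\<bar>
                                       \<le> sqrt (prob_space.variance M X)})"

end

theory Submission
  imports Defs
begin

text \<open>The Skellam variable \<open>Y\<close> with parameter \<open>\<lambda>\<close> has mean 0 and variance \<open>2\<lambda>\<close>, and its distribution
  is symmetric, unimodal and a convolution semigroup in \<open>\<lambda>\<close>. Since convolution can only decrease the
  mass that a symmetric unimodal law gives to a centred window, \<open>P(\<bar>Y\<bar> < n)\<close> is antitone in \<open>\<lambda>\<close>, so the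
  infima are governed by the points \<open>2\<lambda> = n\<^sup>2\<close>. For \<open>n = 1\<close> the value is the Bessel-type series, which
  is at most \<open>exp (-3/4) \<le> 19/40\<close>; for \<open>n = 2\<close> a partial sum exceeds this bound, and for \<open>n \<ge> 3\<close> so
  does the discrete Gauss inequality, which gives \<open>(2n-1) / sqrt (12n\<^sup>2+1)\<close>. The value at
  \<open>\<lambda> = 1/2\<close> is a limit of \<open>P\<^sub>\<lambda>\<close> from the left, where the closed window is still \<open>{0}\<close>.\<close>

section \<open>Symmetric unimodal distributions on the integers\<close>

lemma nat_pmf_sums:
  fixes f :: "nat \<Rightarrow> 'b::{banach, second_countable_topology}"
  assumes "integrable (measure_pmf p) f"
  shows "(\<lambda>k. pmf p k *\<^sub>R f k) sums measure_pmf.expectation p f"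
proof -
  have "integrable (count_space UNIV) (\<lambda>k. pmf p k *\<^sub>R f k)"
    using assms by (simp add: measure_pmf_eq_density integrable_density)
  from sums_integral_count_space_nat[OF this] show ?thesis
    by (simp add: measure_pmf_eq_density integral_density)
qed

lemma nat_pmf_integrable:
  fixes f :: "nat \<Rightarrow> real"
  assumes "\<And>k. 0 \<le> f k" and "(\<lambda>k. pmf p k * f k) sums s"
  shows "integrable (measure_pmf p) f" and "measure_pmf.expectation p f = s"
proof -
  have "integrable (count_space UNIV) (\<lambda>k. pmf p k *\<^sub>R f k)"
    using assms by (auto simp: integrable_count_space_nat_iff sums_iff)
  then show i: "integrable (measure_pmf p) f"
    by (simp add: measure_pmf_eq_density integrable_density)
  show "measure_pmf.expectation p f = s"
    using sums_unique2[OF nat_pmf_sums[OF i]] assms(2) by simp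
qed

text \<open>Abel summation in inequality form: since \<open>a\<close> decreases and the partial sums
  of \<open>b\<close> are nonnegative, each partial sum of \<open>a k * b k\<close> is at least
  \<open>a m\<close> times that of \<open>b\<close>.\<close>

lemma suminf_decseq_mult_nonneg:
  fixes a b :: "nat \<Rightarrow> real"
  assumes "\<And>k. 0 \<le> a k" and "decseq a" and "\<And>m. 0 \<le> (\<Sum>k\<le>m. b k)"
    and "(\<lambda>k. a k * b k) sums s"
  shows "0 \<le> s"
proof -
  have *: "a m * (\<Sum>k\<le>m. b k) \<le> (\<Sum>k\<le>m. a k * b k)" for m
  proof (induction m)
    case (Suc m)
    have "a (Suc m) * (\<Sum>k\<le>m. b k) \<le> a m * (\<Sum>k\<le>m. b k)"
      using assms(2,3) by (intro mult_right_mono) (auto simp: decseq_Suc_iff)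
    with Suc show ?case by (simp add: distrib_left)
  qed simp
  have "0 \<le> (\<Sum>k\<le>m. a k * b k)" for m
    using * assms(1,3) by (meson mult_nonneg_nonneg order_trans)
  moreover have "(\<lambda>m. \<Sum>k\<le>m. a k * b k) \<longlonglongrightarrow> s"
    using assms(4) by (simp add: sums_def_le)
  ultimately show ?thesis by (intro LIMSEQ_le_const) auto
qed

text \<open>The cubic in \<open>M\<close> touches the constant \<open>N\<close> at
  \<open>M = s\<close>, where the difference has the factor
  \<open>(M - s)\<^sup>2 * (M + 2 * s)\<close>; its linear coefficient is at most 1, which keeps it
  below \<open>M\<close>. Divided by \<open>M\<close>, it is the tangent of \<open>N / M\<close> as
  a function of \<open>M\<^sup>2\<close> at \<open>s\<^sup>2\<close>.\<close>

lemma min_ge_cubic: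
  fixes M N s :: real
  assumes "0 \<le> M" "0 \<le> N" "0 < s" "3 * N \<le> 2 * s"
  shows "3 * N / (2 * s) * M - N / (2 * s ^ 3) * M ^ 3 \<le> min M N"
proof -
  have "3 * N / (2 * s) * M \<le> 1 * M"
    using assms by (intro mult_right_mono) (auto simp: field_simps)
  moreover have "0 \<le> N / (2 * s ^ 3) * M ^ 3" using assms by simp
  ultimately have 1: "3 * N / (2 * s) * M - N / (2 * s ^ 3) * M ^ 3 \<le> M" by linarith
  have "0 \<le> (M - s)\<^sup>2 * (M + 2 * s)" using assms by simp
  also have "\<dots> = M ^ 3 + 2 * s ^ 3 - 3 * M * s\<^sup>2"
    by (simp add: power2_eq_square power3_eq_cube algebra_simps)
  finally have "N * (3 * M * s\<^sup>2 - M ^ 3) \<le> N * (2 * s ^ 3)"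
    using assms by (intro mult_left_mono) auto
  then have "N * (3 * M * s\<^sup>2 - M ^ 3) / (2 * s ^ 3) \<le> N"
    using assms by (simp add: divide_simps)
  also have "N * (3 * M * s\<^sup>2 - M ^ 3) / (2 * s ^ 3) = 3 * N / (2 * s) * M - N / (2 * s ^ 3) * M ^ 3"
    using assms by (simp add: field_simps power2_eq_square power3_eq_cube)
  finally show ?thesis using 1 by simp
qed

section \<open>Symmetric unimodal laws and their centred windows\<close>

definition symm_unimodal :: "int pmf \<Rightarrow> bool" where
  "symm_unimodal p \<longleftrightarrow>
     (\<forall>k. pmf p (- k) = pmf p k) \<and> (\<forall>k::nat. pmf p (int (Suc k)) \<le> pmf p (int k))"

lemma symm_unimodal_uminus: "symm_unimodal p \<Longrightarrow> pmf p (- k) = pmf p k"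
  by (simp add: symm_unimodal_def)

lemma symm_unimodal_antimono:
  assumes "symm_unimodal p" and "\<bar>j\<bar> \<le> \<bar>k\<bar>"
  shows "pmf p k \<le> pmf p j"
proof -
  have "decseq (\<lambda>k. pmf p (int k))"
    using assms(1) by (simp add: symm_unimodal_def decseq_Suc_iff)
  then have "pmf p \<bar>k\<bar> \<le> pmf p \<bar>j\<bar>"
    using assms(2) decseqD[of "\<lambda>k. pmf p (int k)" "nat \<bar>j\<bar>" "nat \<bar>k\<bar>"] by simp
  moreover have "pmf p \<bar>i\<bar> = pmf p i" for i
    using symm_unimodal_uminus[OF assms(1), of i] by (auto simp: abs_if)
  ultimately show ?thesis by simp
qed

lemma pmf_map_nat_abs:
  fixes p :: "int pmf"
  assumes "symm_unimodal p"
  shows "pmf (map_pmf (\<lambda>y. nat \<bar>y\<bar>) p) k = (if k = 0 then 1 else 2) * pmf p (int k)"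
proof -
  have "(\<lambda>y. nat \<bar>y\<bar>) -` {k} = {int k, - int k}" by auto
  then show ?thesis
    using symm_unimodal_uminus[OF assms, of "int k"]
    by (simp add: pmf_map measure_measure_pmf_finite)
qed

lemma sum_symm_weights:
  fixes f :: "nat \<Rightarrow> real"
  shows "(\<Sum>k\<le>m. (if k = 0 then 1 else 2) * f k) = 2 * (\<Sum>k\<le>m. f k) - f 0"
  by (induction m) (auto simp: algebra_simps)

lemma sum_indicator_lessThan:
  "(\<Sum>k\<le>m. indicator {..<n} k) = min (real m + 1) (real n)"
proof -
  have "(\<Sum>k\<le>m. indicator {..<n} k) = real (card ({..m} \<inter> {..<n}))"
    by (simp add: indicator_def sum.If_cases) (simp add: Int_def)
  also have "{..m} \<inter> {..<n} = {..<min (Suc m) n}" by auto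
  finally show ?thesis by simp
qed

lemma sum_squares_atMost:
  "(\<Sum>k\<le>m. (real k)\<^sup>2) = real m * (real m + 1) * (2 * real m + 1) / 6"
  by (induction m) (auto simp: power2_eq_square field_simps)

text \<open>A symmetric unimodal distribution on the integers is a
  mixture of uniform distributions on \<open>{-m..m}\<close>, for which the probability of \<open>{-(n-1)..n-1}\<close>
  is \<open>min 1 ((2n-1)/(2m+1))\<close>. The proof bounds this by the tangent in the variance at
  \<open>(2m+1)\<^sup>2 = 12v+1\<close>; the mixture is replaced by summation by parts.\<close>

lemma discrete_Gauss_inequality:
  fixes p :: "int pmf"
  assumes p: "symm_unimodal p" and "integrable (measure_pmf p) (\<lambda>y. (real_of_int y)\<^sup>2)"
    and "n \<ge> 1"
  defines "s \<equiv> sqrt (12 * measure_pmf.expectation p (\<lambda>y. (real_of_int y)\<^sup>2) + 1)"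
  assumes le: "3 * (2 * real n - 1) \<le> 2 * s"
  shows "(2 * real n - 1) / s \<le> measure_pmf.prob p {y. \<bar>y\<bar> < int n}"
proof -
  define v where "v = measure_pmf.expectation p (\<lambda>y. (real_of_int y)\<^sup>2)"
  define N where "N = 2 * real n - 1"
  define \<alpha> where "\<alpha> = 3 * N / (2 * s)"
  define \<beta> where "\<beta> = N / (2 * s ^ 3)"
  \<comment> \<open>The expectation of \<open>h\<close> under \<open>q\<close> is the wanted
    probability minus \<open>\<alpha>\<close> plus \<open>\<beta> * s\<^sup>2\<close>. The form
    \<open>12 * k\<^sup>2 + 1\<close> is chosen because its sum over \<open>{-m..m}\<close> is
    exactly \<open>(2 * m + 1) ^ 3\<close>, so that the partial sums weighted by \<open>w\<close>
    become the cubic expression of \<open>min_ge_cubic\<close> with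
    \<open>M = 2 * m + 1\<close>.\<close>
  define h where "h k = indicator {..<n} k - \<alpha> + \<beta> * (12 * (real k)\<^sup>2 + 1)" for k
  define w :: "nat \<Rightarrow> real" where "w k = (if k = 0 then 1 else 2)" for k
  define q where "q = map_pmf (\<lambda>y. nat \<bar>y\<bar>) p"
  have v: "0 \<le> v" unfolding v_def by (rule Bochner_Integration.integral_nonneg) auto
  have s: "0 < s" "s\<^sup>2 = 12 * v + 1" using v by (auto simp: s_def v_def[symmetric])
  have N: "0 \<le> N" using \<open>n \<ge> 1\<close> by (simp add: N_def)
  have le': "3 * N \<le> 2 * s" using le by (simp add: N_def)
  have int: "integrable q (\<lambda>k. (real k)\<^sup>2)"
    using assms(2) by (simp add: q_def integrable_map_pmf_eq)
  have Ev: "measure_pmf.expectation q (\<lambda>k. (real k)\<^sup>2) = v"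
    by (simp add: q_def v_def)
  have ind: "integrable q (indicator {..<n} :: nat \<Rightarrow> real)"
    by (rule measure_pmf.integrable_const_bound[where B = 1]) auto
  have inth: "integrable q h"
    unfolding h_def using int
    by (intro Bochner_Integration.integrable_add Bochner_Integration.integrable_diff
        integrable_mult_right measure_pmf.integrable_const ind)
  have "measure_pmf.expectation q h = measure_pmf.prob q {..<n} - \<alpha> + \<beta> * (12 * v + 1)"
    unfolding h_def using int ind by (simp add: Ev)
  moreover have "measure_pmf.prob q {..<n} = measure_pmf.prob p {y. \<bar>y\<bar> < int n}"
    unfolding q_def by (simp add: vimage_def) (rule arg_cong[where f = "measure_pmf.prob p"], use assms in auto)
  ultimately have "(\<lambda>k. pmf q k * h k) sums
      (measure_pmf.prob p {y. \<bar>y\<bar> < int n} - \<alpha> + \<beta> * (12 * v + 1))"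
    using nat_pmf_sums[OF inth] by simp
  then have sm: "(\<lambda>k. pmf p (int k) * (w k * h k)) sums
      (measure_pmf.prob p {y. \<bar>y\<bar> < int n} - \<alpha> + \<beta> * (12 * v + 1))"
    unfolding q_def pmf_map_nat_abs[OF p] w_def by (simp add: ac_simps)
  have sb: "0 \<le> (\<Sum>k\<le>m. w k * h k)" for m
  proof -
    define M where "M = 2 * real m + 1"
    have "(\<Sum>k\<le>m. w k * h k) = 2 * (\<Sum>k\<le>m. h k) - h 0"
      unfolding w_def by (rule sum_symm_weights)
    also have "(\<Sum>k\<le>m. h k) = min (real m + 1) (real n) - \<alpha> * (real m + 1)
        + \<beta> * (2 * real m * (real m + 1) * (2 * real m + 1) + (real m + 1))"
      unfolding h_def
      by (simp add: sum.distrib sum_subtractf sum_indicator_lessThan sum_squares_atMost flip: sum_distrib_left) (simp add: algebra_simps)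
    also have "h 0 = 1 - \<alpha> + \<beta>" using assms by (simp add: h_def)
    also have "2 * (min (real m + 1) (real n) - \<alpha> * (real m + 1)
        + \<beta> * (2 * real m * (real m + 1) * (2 * real m + 1) + (real m + 1))) - (1 - \<alpha> + \<beta>)
        = min M N - \<alpha> * M + \<beta> * M ^ 3"
      by (auto simp: M_def N_def power3_eq_cube min_def algebra_simps)
    finally show ?thesis
      using min_ge_cubic[of M N s] N s(1) le' unfolding \<alpha>_def \<beta>_def M_def by linarith
  qed
  have dec: "decseq (\<lambda>k. pmf p (int k))"
    using p by (simp add: symm_unimodal_def decseq_Suc_iff)
  have "0 \<le> measure_pmf.prob p {y. \<bar>y\<bar> < int n} - \<alpha> + \<beta> * s\<^sup>2"
    unfolding s(2) by (rule suminf_decseq_mult_nonneg[OF pmf_nonneg dec sb sm])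
  moreover have "\<beta> * s\<^sup>2 = N / (2 * s)"
    using s(1) by (simp add: \<beta>_def power2_eq_square power3_eq_cube)
  moreover have "\<alpha> - N / (2 * s) = N / s"
    using s(1) by (simp add: \<alpha>_def divide_simps)
  ultimately show ?thesis unfolding N_def by linarith
qed

text \<open>Moving the centre from \<open>z \<ge> 0\<close> to \<open>z + 1\<close> trades the
  weight at \<open>z - n + 1\<close> for the weight at \<open>z + n\<close>, which is farther from
  0. Induction handles centres on one side, symmetry the other.\<close>

lemma symm_unimodal_window:
  fixes p :: "int pmf"
  assumes "symm_unimodal p"
  shows "measure_pmf.prob p {k. \<bar>k + z\<bar> < int n} \<le> measure_pmf.prob p {k. \<bar>k\<bar> < int n}"
proof -
  define W where "W z = measure_pmf.prob p {z - int n<..<z + int n}" for z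
  have step: "W (int (Suc z)) \<le> W (int z)" for z
  proof (cases "n = 0")
    case False
    have "{int (Suc z) - int n<..<int (Suc z) + int n} =
        insert (int z + int n) {int z - int n + 1<..<int z + int n}" using False by auto
    then have "W (int (Suc z)) = pmf p (int z + int n) + sum (pmf p) {int z - int n + 1<..<int z + int n}"
      by (simp add: W_def measure_measure_pmf_finite)
    moreover have "{int z - int n<..<int z + int n} =
        insert (int z - int n + 1) {int z - int n + 1<..<int z + int n}" using False by auto
    then have "W (int z) = pmf p (int z - int n + 1) + sum (pmf p) {int z - int n + 1<..<int z + int n}"
      by (simp add: W_def measure_measure_pmf_finite)
    moreover have "pmf p (int z + int n) \<le> pmf p (int z - int n + 1)"
      using False by (intro symm_unimodal_antimono[OF assms]) auto
    ultimately show ?thesis by simp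
  qed (simp add: W_def)
  have W0: "W (int z) \<le> W 0" for z
  proof (induction z)
    case (Suc z)
    with step[of z] show ?case by linarith
  qed simp
  have sym: "W (- z) = W z" for z
  proof -
    have "{- z - int n<..<- z + int n} = uminus ` {z - int n<..<z + int n}"
      by (simp add: add.commute)
    then show ?thesis unfolding W_def
      by (simp add: measure_measure_pmf_finite sum.reindex symm_unimodal_uminus[OF assms]
          del: image_uminus_greaterThanLessThan)
  qed
  have "{k. \<bar>k + z\<bar> < int n} = {- z - int n<..<- z + int n}" by auto
  then have "measure_pmf.prob p {k. \<bar>k + z\<bar> < int n} = W (- z)" by (simp add: W_def)
  also have "\<dots> \<le> W 0"
    using W0[of "nat \<bar>z\<bar>"] sym[of z] by (cases "z \<ge> 0") auto
  also have "\<dots> = measure_pmf.prob p {k. \<bar>k\<bar> < int n}"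
    unfolding W_def by (rule arg_cong[where f = "measure_pmf.prob p"]) auto
  finally show ?thesis .
qed

text \<open>Conditioned on the second summand, the event is a shifted window for \<open>p\<close>;
  averaging over \<open>q\<close> keeps the bound for shifted windows.\<close>

lemma symm_unimodal_add:
  fixes p q :: "int pmf"
  assumes "symm_unimodal p"
  shows "measure_pmf.prob (map_pmf (\<lambda>(x, y). x + y) (pair_pmf p q)) {k. \<bar>k\<bar> < int n}
     \<le> measure_pmf.prob p {k. \<bar>k\<bar> < int n}"
proof -
  have eq: "map_pmf (\<lambda>(x, y). x + y) (pair_pmf p q) = bind_pmf q (\<lambda>y. map_pmf (\<lambda>x. x + y) p)"
    by (subst pair_commute_pmf) (simp add: pair_pmf_def map_pmf_def bind_assoc_pmf bind_return_pmf)
  have "emeasure (map_pmf (\<lambda>(x, y). x + y) (pair_pmf p q)) {k. \<bar>k\<bar> < int n}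
      = (\<integral>\<^sup>+y. emeasure p {x. \<bar>x + y\<bar> < int n} \<partial>q)"
    unfolding eq by (simp add: vimage_def)
  also have "\<dots> \<le> (\<integral>\<^sup>+y. emeasure p {k. \<bar>k\<bar> < int n} \<partial>q)"
    using symm_unimodal_window[OF assms]
    by (intro nn_integral_mono) (simp add: measure_pmf.emeasure_eq_measure)
  also have "\<dots> = emeasure p {k. \<bar>k\<bar> < int n}" by simp
  finally show ?thesis by (simp add: measure_pmf.emeasure_eq_measure)
qed

section \<open>Skellam distributions\<close>

text \<open>Preimages under \<open>fst\<close> and \<open>snd\<close> are intersection-stable and
  meet in rectangles, whose probability factors. This is what lets mixed moments and characteristic
  functions factor below.\<close>

lemma indep_var_pair_pmf:
  fixes p q :: "'a::countable pmf"
  shows "prob_space.indep_var (measure_pmf (pair_pmf p q)) (count_space UNIV) fst (count_space UNIV) snd"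
proof -
  let ?G = "\<lambda>f. {f -` A \<inter> space (measure_pmf (pair_pmf p q)) | A. A \<in> sets (count_space (UNIV :: 'a set))}"
  have st: "Int_stable (?G f)" for f
  proof (rule Int_stableI)
    fix a b assume "a \<in> ?G f" "b \<in> ?G f"
    then obtain A B where "a = f -` A" "b = f -` B" by auto
    then show "a \<inter> b \<in> ?G f" by (intro CollectI exI[of _ "A \<inter> B"]) auto
  qed
  have "prob_space.indep_set (measure_pmf (pair_pmf p q)) (?G fst) (?G snd)"
  proof (rule prob_space.indep_setI[OF prob_space_measure_pmf])
    fix a b assume "a \<in> ?G fst" "b \<in> ?G snd"
    then obtain A B where ab: "a = fst -` A" "b = snd -` B" by auto
    have eq: "a = A \<times> UNIV" "b = UNIV \<times> B" "a \<inter> b = A \<times> B" using ab by auto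
    show "measure_pmf.prob (pair_pmf p q) (a \<inter> b)
        = measure_pmf.prob (pair_pmf p q) a * measure_pmf.prob (pair_pmf p q) b"
      unfolding eq(3) unfolding eq(1,2) by (simp add: measure_pmf_prob_product)
  qed auto
  then show ?thesis
    unfolding prob_space.indep_var_eq[OF prob_space_measure_pmf]
    by (intro conjI prob_space.indep_set_sigma_sets[OF prob_space_measure_pmf _ st st]) auto
qed

lemma indep_var_pair_pmf_borel:
  fixes p q :: "'a::countable pmf" and f g :: "'a \<Rightarrow> real"
  shows "prob_space.indep_var (measure_pmf (pair_pmf p q))
    borel (\<lambda>x. f (fst x)) borel (\<lambda>x. g (snd x))"
  by (rule prob_space.indep_var_compose[OF prob_space_measure_pmf indep_var_pair_pmf,
        of f borel g borel p q, unfolded comp_def]) simp_all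

lemma integrable_fst_pmf:
  fixes f :: "_ \<Rightarrow> real"
  assumes "integrable (measure_pmf p) f"
  shows "integrable (measure_pmf (pair_pmf p q)) (\<lambda>x. f (fst x))"
proof -
  have "integrable (measure_pmf (map_pmf fst (pair_pmf p q))) f"
    using assms by (simp add: map_fst_pair_pmf)
  then show ?thesis by (simp add: integrable_map_pmf_eq)
qed

lemma integrable_snd_pmf:
  fixes f :: "_ \<Rightarrow> real"
  assumes "integrable (measure_pmf q) f"
  shows "integrable (measure_pmf (pair_pmf p q)) (\<lambda>x. f (snd x))"
proof -
  have "integrable (measure_pmf (map_pmf snd (pair_pmf p q))) f"
    using assms by (simp add: map_snd_pair_pmf)
  then show ?thesis by (simp add: integrable_map_pmf_eq)
qed

text \<open>This is the identity E[N f(N - 1)] = lam E[f(N)], from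
  \<open>k * pmf k = lam * pmf (k - 1)\<close>. The truncated \<open>k - 1\<close> at
  \<open>k = 0\<close> is harmless because of the factor \<open>k\<close>. Taking \<open>f\<close>
  to be 1 and then \<open>k + 1\<close> yields the first two moments.\<close>

lemma poisson_sums_shift:
  fixes lam :: real
  assumes "0 < lam"
  shows "(\<lambda>k. pmf (poisson_pmf lam) k * (real k * f (k - 1))) sums (lam * s)
     \<longleftrightarrow> (\<lambda>k. pmf (poisson_pmf lam) k * f k) sums s"
proof -
  have "(\<lambda>k. pmf (poisson_pmf lam) k * (real k * f (k - 1))) sums (lam * s)
      \<longleftrightarrow> (\<lambda>k. pmf (poisson_pmf lam) (Suc k) * (real (Suc k) * f k)) sums (lam * s)"
    using sums_Suc_iff[of "\<lambda>k. pmf (poisson_pmf lam) k * (real k * f (k - 1))" "lam * s"] by simp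
  also have "(\<lambda>k. pmf (poisson_pmf lam) (Suc k) * (real (Suc k) * f k))
      = (\<lambda>k. lam * (pmf (poisson_pmf lam) k * f k))"
    using assms by (simp add: fun_eq_iff fact_Suc divide_simps del: of_nat_Suc)
  finally show ?thesis using assms sums_mult_iff[of lam "\<lambda>k. pmf (poisson_pmf lam) k * f k" s]
    by (simp del: pmf_poisson)
qed

lemma pmf_nat_sums_1: "(\<lambda>k. pmf p k) sums (1::real)" for p :: "nat pmf"
  using nat_pmf_sums[of p "\<lambda>_. 1 :: real"] by simp

lemma poisson_moments:
  assumes "0 < lam"
  shows "integrable (poisson_pmf lam) real" "measure_pmf.expectation (poisson_pmf lam) real = lam"
    "integrable (poisson_pmf lam) (\<lambda>k. (real k)\<^sup>2)"
    "measure_pmf.expectation (poisson_pmf lam) (\<lambda>k. (real k)\<^sup>2) = lam\<^sup>2 + lam"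
proof -
  have 0: "(\<lambda>k. pmf (poisson_pmf lam) k * 1) sums 1"
    using pmf_nat_sums_1 by simp
  have 1: "(\<lambda>k. pmf (poisson_pmf lam) k * real k) sums lam"
    using poisson_sums_shift[OF assms, of "\<lambda>_. 1" 1] 0 by simp
  have "(\<lambda>k. pmf (poisson_pmf lam) k * (real k + 1)) sums (lam + 1)"
    using sums_add[OF 1 0] by (simp add: algebra_simps)
  then have "(\<lambda>k. pmf (poisson_pmf lam) k * (real k * (real (k - 1) + 1))) sums (lam * (lam + 1))"
    using poisson_sums_shift[OF assms, of "\<lambda>k. real k + 1"] by simp
  moreover have "real k * (real (k - 1) + 1) = (real k)\<^sup>2" for k
    by (cases k) (auto simp: power2_eq_square)
  moreover have "lam * (lam + 1) = lam\<^sup>2 + lam"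
    by (simp add: power2_eq_square algebra_simps)
  ultimately have 2: "(\<lambda>k. pmf (poisson_pmf lam) k * (real k)\<^sup>2) sums (lam\<^sup>2 + lam)"
    by simp
  show "integrable (poisson_pmf lam) real" "measure_pmf.expectation (poisson_pmf lam) real = lam"
    using nat_pmf_integrable[OF _ 1] by auto
  show "integrable (poisson_pmf lam) (\<lambda>k. (real k)\<^sup>2)"
    "measure_pmf.expectation (poisson_pmf lam) (\<lambda>k. (real k)\<^sup>2) = lam\<^sup>2 + lam"
    using nat_pmf_integrable[OF _ 2] by auto
qed

lemma skellam_moments:
  assumes "0 < lam"
  shows "measure_pmf.expectation (skellam_pmf lam) real_of_int = 0"
    "integrable (skellam_pmf lam) (\<lambda>y. (real_of_int y)\<^sup>2)"
    "measure_pmf.expectation (skellam_pmf lam) (\<lambda>y. (real_of_int y)\<^sup>2) = 2 * lam"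
proof -
  let ?P = "poisson_pmf lam" and ?M = "pair_pmf (poisson_pmf lam) (poisson_pmf lam)"
  note m = poisson_moments[OF assms]
  note i1 = integrable_fst_pmf[OF m(1), of ?P] integrable_snd_pmf[OF m(1), of ?P]
  note i2 = integrable_fst_pmf[OF m(3), of ?P] integrable_snd_pmf[OF m(3), of ?P]
  have e: "measure_pmf.expectation ?M (\<lambda>x. real (fst x)) = lam"
    "measure_pmf.expectation ?M (\<lambda>x. real (snd x)) = lam"
    "measure_pmf.expectation ?M (\<lambda>x. (real (fst x))\<^sup>2) = lam\<^sup>2 + lam"
    "measure_pmf.expectation ?M (\<lambda>x. (real (snd x))\<^sup>2) = lam\<^sup>2 + lam"
    using expectation_pair_pmf_fst[of ?P ?P real] expectation_pair_pmf_snd[of ?P ?P real]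
      expectation_pair_pmf_fst[of ?P ?P "\<lambda>k. (real k)\<^sup>2"] expectation_pair_pmf_snd[of ?P ?P "\<lambda>k. (real k)\<^sup>2"] m
    by simp_all
  have i3: "integrable ?M (\<lambda>x. real (fst x) * real (snd x))"
    using prob_space.indep_var_integrable[OF prob_space_measure_pmf indep_var_pair_pmf_borel i1] .
  have e3: "measure_pmf.expectation ?M (\<lambda>x. real (fst x) * real (snd x)) = lam * lam"
    using prob_space.indep_var_lebesgue_integral[OF prob_space_measure_pmf indep_var_pair_pmf_borel i1] e by simp
  have sk: "skellam_pmf lam = map_pmf (\<lambda>x. int (fst x) - int (snd x)) ?M"
    by (simp add: skellam_pmf_def case_prod_unfold)
  have sq: "(real (fst x) - real (snd x))\<^sup>2 =
      (real (fst x))\<^sup>2 + (real (snd x))\<^sup>2 - 2 * (real (fst x) * real (snd x))" for x :: "nat \<times> nat"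
    by (simp add: power2_eq_square algebra_simps)
  show "measure_pmf.expectation (skellam_pmf lam) real_of_int = 0"
    using i1 e by (simp add: sk)
  show "integrable (skellam_pmf lam) (\<lambda>y. (real_of_int y)\<^sup>2)"
    using i2 i3 by (simp add: sk integrable_map_pmf_eq sq)
  show "measure_pmf.expectation (skellam_pmf lam) (\<lambda>y. (real_of_int y)\<^sup>2) = 2 * lam"
    using i2 i3 e e3 by (simp add: sk sq) (simp add: power2_eq_square)
qed

section \<open>Symmetry and unimodality of the Skellam weights\<close>

lemma skellam_uminus:
  "map_pmf uminus (skellam_pmf lam) = skellam_pmf lam"
proof -
  have "map_pmf uminus (skellam_pmf lam) = map_pmf (\<lambda>(a, b). int b - int a) (pair_pmf (poisson_pmf lam) (poisson_pmf lam))"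
    by (simp add: skellam_pmf_def map_pmf_comp case_prod_unfold)
  also have "\<dots> = skellam_pmf lam"
    unfolding skellam_pmf_def by (subst pair_commute_pmf) (simp add: map_pmf_comp case_prod_unfold)
  finally show ?thesis .
qed

lemma pmf_skellam_uminus: "pmf (skellam_pmf lam) (- k) = pmf (skellam_pmf lam) k"
  using pmf_map_inj'[of uminus "skellam_pmf lam" k] by (simp add: skellam_uminus)

lemma pmf_skellam_sums:
  "(\<lambda>j. pmf (poisson_pmf lam) (j + k) * pmf (poisson_pmf lam) j) sums pmf (skellam_pmf lam) (int k)"
proof -
  let ?M = "pair_pmf (poisson_pmf lam) (poisson_pmf lam)"
  have "(\<lambda>j. measure_pmf.prob ?M {(j + k, j)}) sums measure_pmf.prob ?M (\<Union>j. {(j + k, j)})"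
    by (intro measure_pmf.finite_measure_UNION) (auto simp: disjoint_family_on_def)
  also have "(\<Union>j. {(j + k, j)}) = (\<lambda>(a, b). int a - int b) -` {int k}" by auto
  also have "measure_pmf.prob ?M \<dots> = pmf (skellam_pmf lam) (int k)"
    by (simp add: skellam_pmf_def pmf_map)
  finally show ?thesis by (simp add: measure_pmf_single pmf_pair)
qed


text \<open>Sum \<open>2 * x * y \<le> x\<^sup>2 + y\<^sup>2\<close> over consecutive Poisson
  weights; the squares add up to twice the weight at 0, less the first square.\<close>

lemma pmf_skellam_0_1: "pmf (skellam_pmf lam) 1 \<le> pmf (skellam_pmf lam) 0"
proof -
  let ?q = "pmf (poisson_pmf lam)"
  let ?p = "pmf (skellam_pmf lam)"
  have 0: "(\<lambda>j. ?q j * ?q j) sums ?p 0"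
    using pmf_skellam_sums[of lam 0] by simp
  have "(\<lambda>j. ?q (Suc j) * ?q (Suc j)) sums (?p 0 - ?q 0 * ?q 0)"
    using 0 sums_Suc_iff[of "\<lambda>j. ?q j * ?q j" "?p 0 - ?q 0 * ?q 0"] by simp
  from sums_add[OF 0 this]
  have 1: "(\<lambda>j. ?q j * ?q j + ?q (Suc j) * ?q (Suc j)) sums (2 * ?p 0 - ?q 0 * ?q 0)"
    by simp
  have 2: "(\<lambda>j. 2 * (?q (Suc j) * ?q j)) sums (2 * ?p 1)"
    using sums_mult[OF pmf_skellam_sums[of lam 1], of 2] by simp
  have "2 * ?p 1 \<le> 2 * ?p 0 - ?q 0 * ?q 0"
  proof (rule sums_le[OF _ 2 1])
    fix j show "2 * (?q (Suc j) * ?q j) \<le> ?q j * ?q j + ?q (Suc j) * ?q (Suc j)"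
      using sum_squares_bound[of "?q (Suc j)" "?q j"] by (simp add: power2_eq_square)
  qed
  then show ?thesis using zero_le_square[of "?q 0"] by linarith
qed

text \<open>With \<open>q\<close> the Poisson weights and \<open>d b = q b - q (b + 1)\<close>, the difference of two consecutive
  weights is \<open>\<Sum>b. d b * q (b - k)\<close>. The ratio \<open>q (b - k) / q b\<close> increases with \<open>b\<close> and \<open>d\<close> changes
  sign once, from negative to positive, so replacing this ratio by its value at the sign change only
  decreases the sum; that reduces the claim to \<open>k = 0\<close>.\<close>

lemma pmf_skellam_Suc_le:
  assumes "0 < lam"
  shows "pmf (skellam_pmf lam) (int (Suc k)) \<le> pmf (skellam_pmf lam) (int k)"
proof -
  define q where "q = pmf (poisson_pmf lam)"
  define d where "d b = q b - q (Suc b)" for b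
  \<comment> \<open>\<open>G b\<close> is the ratio \<open>q (b - k) / q b\<close> in product form.
    For \<open>b < k\<close> the factor with \<open>i = b\<close> is 0, so the series in
    \<open>j\<close> can be reindexed by \<open>b = j + k\<close> and started at 0.\<close>
  define G where "G b = (\<Prod>i<k. real (b - i) / lam)" for b
  \<comment> \<open>The sign change: \<open>d b\<close> has the sign of \<open>b + 1 - lam\<close>,
    and \<open>m\<close> is the first index where this is nonnegative.\<close>
  define m where "m = nat \<lceil>lam - 1\<rceil>"
  let ?p = "pmf (skellam_pmf lam)"
  have q_Suc: "q (Suc j) * real (Suc j) = lam * q j" for j
    using assms by (simp add: q_def field_simps del: of_nat_Suc)
  have q_prod: "q j = q (j + k) * (\<Prod>i<k. real (j + k - i) / lam)" for j
  proof (induction k arbitrary: j)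
    case (Suc k)
    have "q j = q (Suc j) * (real (Suc j) / lam)"
      using q_Suc[of j] assms by (simp add: field_simps)
    also have "q (Suc j) = q (Suc j + k) * (\<Prod>i<k. real (Suc j + k - i) / lam)"
      by (rule Suc)
    finally show ?case by (simp add: Suc_diff_le)
  qed simp
  have G: "q j = q (j + k) * G (j + k)" for j
    using q_prod[of j] unfolding G_def .
  have G_0: "G b = 0" if "b < k" for b
    unfolding G_def by (rule prod_zero) (use that in \<open>auto intro: bexI[of _ b]\<close>)
  have G_nonneg: "0 \<le> G b" for b
    unfolding G_def by (rule prod_nonneg) (use assms in simp)
  have G_mono: "G b \<le> G c" if "b \<le> c" for b c
    unfolding G_def by (rule prod_mono) (use that assms in \<open>simp add: divide_right_mono\<close>)
  have "(\<lambda>j. q (j + k) * q j - q (j + Suc k) * q j) sums (?p (int k) - ?p (int (Suc k)))"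
    unfolding q_def by (intro sums_diff pmf_skellam_sums)
  also have "(\<lambda>j. q (j + k) * q j - q (j + Suc k) * q j)
      = (\<lambda>j. d (j + k) * q (j + k) * G (j + k))"
  proof
    fix j
    have "q (j + k) * q j - q (j + Suc k) * q j = d (j + k) * q j" by (simp add: d_def algebra_simps)
    then show "q (j + k) * q j - q (j + Suc k) * q j = d (j + k) * q (j + k) * G (j + k)"
      using G[of j] by simp
  qed
  finally have k: "(\<lambda>b. d b * q b * G b) sums (?p (int k) - ?p (int (Suc k)))"
    by (subst (asm) sums_zero_iff_shift) (simp_all add: G_0)
  have "(\<lambda>j. q j * q j - q (j + 1) * q j) sums (?p 0 - ?p 1)"
    using sums_diff[OF pmf_skellam_sums[of lam 0] pmf_skellam_sums[of lam 1]] by (simp add: q_def)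
  then have "(\<lambda>b. d b * q b) sums (?p 0 - ?p 1)"
    by (simp add: d_def algebra_simps)
  then have 0: "(\<lambda>b. d b * q b * G m) sums ((?p 0 - ?p 1) * G m)"
    by (rule sums_mult2)
  have "(?p 0 - ?p 1) * G m \<le> ?p (int k) - ?p (int (Suc k))"
  proof (rule sums_le[OF _ 0 k])
    fix b
    have q: "0 \<le> q b" by (simp add: q_def)
    have "d b * real (Suc b) = q b * (real (Suc b) - lam)"
      using q_Suc[of b] by (simp add: d_def algebra_simps)
    then have d: "d b = q b * ((real (Suc b) - lam) / real (Suc b))"
      by (simp add: divide_simps del: of_nat_Suc)
    show "d b * q b * G m \<le> d b * q b * G b"
    proof (cases "m \<le> b")
      case True
      then have "lam \<le> real (Suc b)" unfolding m_def by linarith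
      then have "0 \<le> d b" unfolding d using q by (intro mult_nonneg_nonneg divide_nonneg_pos) auto
      then show ?thesis using q G_mono[OF True] by (intro mult_left_mono) auto
    next
      case False
      then have "real (Suc b) \<le> lam" unfolding m_def by linarith
      then have "d b \<le> 0" unfolding d
        using q by (intro mult_nonneg_nonpos divide_nonpos_pos) auto
      then have "d b * q b \<le> 0" using q by (rule mult_nonpos_nonneg)
      then show ?thesis using G_mono[of b m] False by (intro mult_left_mono_neg) auto
    qed
  qed
  moreover have "0 \<le> (?p 0 - ?p 1) * G m"
    using pmf_skellam_0_1 G_nonneg by simp
  ultimately show ?thesis by simp
qed

lemma symm_unimodal_skellam: "0 < lam \<Longrightarrow> symm_unimodal (skellam_pmf lam)"
  unfolding symm_unimodal_def using pmf_skellam_uminus pmf_skellam_Suc_le by blast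

section \<open>Characteristic functions and the convolution semigroup\<close>

lemma poisson_char:
  assumes "0 < lam"
  shows "measure_pmf.expectation (poisson_pmf lam) (\<lambda>k. iexp (t * real k)) = exp (lam * (iexp t - 1))"
proof -
  have "integrable (poisson_pmf lam) (\<lambda>k. iexp (t * real k))"
    by (rule measure_pmf.integrable_const_bound[where B = 1]) auto
  note nat_pmf_sums[OF this]
  moreover have "(\<lambda>k. ((lam * iexp t) ^ k /\<^sub>R fact k) * exp (- lam)) sums (exp (lam * iexp t) * exp (- lam))"
    by (intro sums_mult2 exp_converges)
  moreover have "((lam * iexp t) ^ k /\<^sub>R fact k) * exp (- lam) = pmf (poisson_pmf lam) k *\<^sub>R iexp (t * real k)" for k
    using assms
    by (simp add: power_mult_distrib exp_of_nat_mult[symmetric] scaleR_conv_of_real exp_of_real field_simps)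
  moreover have "exp (lam * iexp t) * exp (- lam) = exp (lam * (iexp t - 1))"
    by (simp add: exp_of_real[symmetric] exp_add[symmetric] algebra_simps)
  ultimately show ?thesis by (simp add: sums_iff)
qed

lemma skellam_char:
  assumes "0 < lam"
  shows "char (distr (skellam_pmf lam) borel real_of_int) t = exp (2 * lam * (cos t - 1))"
proof -
  let ?P = "poisson_pmf lam" and ?M = "pair_pmf (poisson_pmf lam) (poisson_pmf lam)"
  have "distr (skellam_pmf lam) borel real_of_int = distr ?M borel (\<lambda>x. real (fst x) + - real (snd x))" (is "?L = _")
    unfolding skellam_pmf_def map_pmf_rep_eq
    by (subst distr_distr) (auto simp: comp_def case_prod_unfold)
  then have "char ?L t
      = char (distr ?M borel (\<lambda>x. real (fst x))) t * char (distr ?M borel (\<lambda>x. - real (snd x))) t"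
    by (simp only: prob_space.char_distr_add[OF prob_space_measure_pmf
          indep_var_pair_pmf_borel[of ?P ?P real "\<lambda>k. - real k"]])
  moreover have "char (distr ?M borel (\<lambda>x. real (fst x))) t = exp (complex_of_real lam * (iexp t - 1))"
  proof -
    have "char (distr ?M borel (\<lambda>x. real (fst x))) t = measure_pmf.expectation ?M (\<lambda>x. iexp (t * real (fst x)))"
      unfolding char_def by (rule integral_distr) auto
    also have "\<dots> = measure_pmf.expectation ?P (\<lambda>k. iexp (t * real k))"
      by (rule expectation_pair_pmf_fst)
    finally show ?thesis unfolding poisson_char[OF assms] .
  qed
  moreover have "char (distr ?M borel (\<lambda>x. - real (snd x))) t = exp (complex_of_real lam * (iexp (- t) - 1))"
  proof -
    have "char (distr ?M borel (\<lambda>x. - real (snd x))) t = measure_pmf.expectation ?M (\<lambda>x. iexp (t * - real (snd x)))"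
      unfolding char_def by (rule integral_distr) auto
    also have "\<dots> = measure_pmf.expectation ?P (\<lambda>k. iexp (t * - real k))"
      by (rule expectation_pair_pmf_snd)
    also have "\<dots> = measure_pmf.expectation ?P (\<lambda>k. iexp (- t * real k))" by simp
    finally show ?thesis unfolding poisson_char[OF assms] .
  qed
  moreover have "complex_of_real lam * (iexp t - 1) + complex_of_real lam * (iexp (- t) - 1) = complex_of_real (2 * lam * (cos t - 1))"
    unfolding cis_conv_exp[symmetric] by (simp add: complex_eq_iff algebra_simps)
  ultimately show ?thesis by (simp only: exp_add[symmetric] exp_of_real)
qed

text \<open>Levy uniqueness on the real line, carried back to integer laws through the masses of
  singletons.\<close>

lemma int_pmf_eqI_char:
  fixes p q :: "int pmf"
  assumes "\<And>t. char (distr p borel real_of_int) t = char (distr q borel real_of_int) t"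
  shows "p = q"
proof -
  have "distr p borel real_of_int = distr q borel real_of_int"
    by (rule Levy_uniqueness)
      (auto simp: real_distribution_def real_distribution_axioms_def assms
        intro!: measure_pmf.prob_space_distr)
  then have "measure (distr p borel real_of_int) {real_of_int x} = measure (distr q borel real_of_int) {real_of_int x}" for x
    by simp
  moreover have "real_of_int -` {real_of_int x} = {x}" for x :: int by auto
  ultimately show ?thesis
    by (intro pmf_eqI) (simp add: measure_distr measure_pmf_single)
qed

text \<open>The exponent of the characteristic function is linear in the parameter, so products of
  characteristic functions add parameters.\<close>

lemma skellam_add:
  assumes "0 < l" "0 < m"
  shows "map_pmf (\<lambda>(x, y). x + y) (pair_pmf (skellam_pmf l) (skellam_pmf m)) = skellam_pmf (l + m)"
proof (rule int_pmf_eqI_char)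
  fix t
  let ?M = "pair_pmf (skellam_pmf l) (skellam_pmf m)"
  have "distr (map_pmf (\<lambda>(x, y). x + y) ?M) borel real_of_int
      = distr ?M borel (\<lambda>x. real_of_int (fst x) + real_of_int (snd x))"
    unfolding map_pmf_rep_eq
    by (subst distr_distr) (auto simp: comp_def case_prod_unfold)
  then have "char (distr (map_pmf (\<lambda>(x, y). x + y) ?M) borel real_of_int) t
      = char (distr ?M borel (\<lambda>x. real_of_int (fst x))) t * char (distr ?M borel (\<lambda>x. real_of_int (snd x))) t"
    by (simp only: prob_space.char_distr_add[OF prob_space_measure_pmf
          indep_var_pair_pmf_borel[of _ _ real_of_int real_of_int]])
  moreover have "distr ?M borel (\<lambda>x. real_of_int (fst x)) = distr (map_pmf fst ?M) borel real_of_int"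
    unfolding map_pmf_rep_eq by (subst distr_distr) (auto simp: comp_def)
  moreover have "distr ?M borel (\<lambda>x. real_of_int (snd x)) = distr (map_pmf snd ?M) borel real_of_int"
    unfolding map_pmf_rep_eq by (subst distr_distr) (auto simp: comp_def)
  moreover have "exp (2 * l * (cos t - 1)) * exp (2 * m * (cos t - 1)) = exp (2 * (l + m) * (cos t - 1))"
    by (simp add: mult_exp_exp algebra_simps)
  ultimately show "char (distr (map_pmf (\<lambda>(x, y). x + y) ?M) borel real_of_int) t
      = char (distr (skellam_pmf (l + m)) borel real_of_int) t"
    using assms by (simp add: map_fst_pair_pmf map_snd_pair_pmf skellam_char flip: of_real_mult)
qed

text \<open>The law with parameter \<open>m\<close> arises from that with parameter \<open>l\<close>
  by adding an independent Skellam variable with parameter \<open>m - l\<close>, which cannot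
  increase the mass of a centred window.\<close>

lemma skellam_prob_antimono:
  assumes "0 < l" "l \<le> m"
  shows "measure_pmf.prob (skellam_pmf m) {k. \<bar>k\<bar> < int n} \<le> measure_pmf.prob (skellam_pmf l) {k. \<bar>k\<bar> < int n}"
proof (cases "l = m")
  case False
  with assms skellam_add[of l "m - l"] symm_unimodal_add[OF symm_unimodal_skellam[of l], of "skellam_pmf (m - l)" n]
  show ?thesis by simp
qed simp

section \<open>Minimization over the parameter\<close>

lemma pmf_skellam_half_0: "pmf (skellam_pmf (1/2)) 0 = exp (-1) * (\<Sum>k. 1 / (2 ^ (2 * k) * (fact k)\<^sup>2))"
  and pmf_skellam_half_0_le: "pmf (skellam_pmf (1/2)) 0 \<le> 19 / 40"
proof -
  have q: "pmf (poisson_pmf (1/2)) j * pmf (poisson_pmf (1/2)) j = exp (-1) * (1 / (2 ^ (2 * j) * (fact j)\<^sup>2))" for j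
    by (simp add: power_mult power2_eq_square power_divide mult_exp_exp field_simps
        flip: power_mult_distrib)
  have *: "(\<lambda>j. exp (-1) * (1 / (2 ^ (2 * j) * (fact j)\<^sup>2))) sums pmf (skellam_pmf (1/2)) 0"
    using pmf_skellam_sums[of "1/2" 0] unfolding of_nat_0 add_0_right q .
  from sums_mult[OF this, of "exp 1"]
  have **: "(\<lambda>j. 1 / (2 ^ (2 * j) * (fact j)\<^sup>2)) sums (exp 1 * pmf (skellam_pmf (1/2)) 0)"
    by (simp add: mult.assoc[symmetric] mult_exp_exp)
  then show "pmf (skellam_pmf (1/2)) 0 = exp (-1) * (\<Sum>k. 1 / (2 ^ (2 * k) * (fact k)\<^sup>2))"
    using sums_unique[OF **] by (simp add: exp_minus field_simps)
  have "(1/4 :: real) ^ j /\<^sub>R fact j = (1/4) ^ j / fact j" for j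
    by (simp add: field_simps)
  then have e: "(\<lambda>j. (1/4 :: real) ^ j / fact j) sums exp (1/4)"
    using exp_converges[of "1/4 :: real"] by (simp only:)
  \<comment> \<open>Dropping one of the two factorials leaves the exponential series at 1/4. The
    threshold 19/40 is a rational slightly above \<open>exp (- (3/4))\<close>.\<close>
  have "exp 1 * pmf (skellam_pmf (1/2)) 0 \<le> exp (1/4)"
  proof (rule sums_le[OF _ ** e])
    fix j
    have "(1::real) / (2 ^ (2 * j) * (fact j)\<^sup>2) = (1/4) ^ j / fact j * (1 / fact j)"
      by (simp add: power_mult power_divide power2_eq_square)
    also have "\<dots> \<le> (1/4) ^ j / fact j * 1"
      by (intro mult_left_mono) auto
    finally show "(1::real) / (2 ^ (2 * j) * (fact j)\<^sup>2) \<le> (1/4) ^ j / fact j"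
      by (simp only: mult_1_right)
  qed
  then have "pmf (skellam_pmf (1/2)) 0 \<le> exp (1/4) / exp 1"
    by (simp add: pos_le_divide_eq mult.commute)
  also have "\<dots> = exp (- (3/4))" by (simp flip: exp_diff)
  also have "\<dots> = 1 / exp (3/4)" by (simp only: exp_minus inverse_eq_divide)
  also have "\<dots> \<le> 19 / 40"
  proof -
    \<comment> \<open>Splitting 3/4 into four steps of 3/16 makes the quadratic Taylor bound sharp
      enough.\<close>
    have "40 / 19 \<le> (1 + 3/16 + (3/16)\<^sup>2 / 2 :: real) ^ 4"
      by (simp add: field_simps eval_nat_numeral)
    also have "\<dots> \<le> exp (3/16) ^ 4"
      by (intro power_mono exp_lower_Taylor_quadratic) auto
    also have "\<dots> = exp (3/4)" by (simp flip: exp_of_nat_mult)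
    finally show ?thesis by (simp add: divide_simps)
  qed
  finally show "pmf (skellam_pmf (1/2)) 0 \<le> 19 / 40" .
qed

text \<open>For \<open>n = 2\<close> the discrete Gauss inequality would give only 3/7, which is
  below 19/40; hence this direct estimate.\<close>

lemma skellam_2_prob_ge: "19 / 40 \<le> measure_pmf.prob (skellam_pmf 2) {k. \<bar>k\<bar> < 2}"
proof -
  define E :: real where "E = exp (- 4)"
  let ?q = "pmf (poisson_pmf 2)" and ?p = "pmf (skellam_pmf 2)"
  have "{k::int. \<bar>k\<bar> < 2} = {0, 1, - 1}" by auto
  then have p: "measure_pmf.prob (skellam_pmf 2) {k. \<bar>k\<bar> < 2} = ?p 0 + 2 * ?p 1"
    using pmf_skellam_uminus[of 2 1] by (simp add: measure_measure_pmf_finite)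
  have q: "?q i * ?q j = E * (2 ^ i * 2 ^ j / (fact i * fact j))" for i j
    by (simp add: E_def mult_exp_exp field_simps)
  have "(\<Sum>j<4. ?q (j + k) * ?q j) \<le> ?p (int k)" for k
    unfolding sums_unique[OF pmf_skellam_sums]
    by (rule sum_le_suminf[OF sums_summable[OF pmf_skellam_sums]]) simp_all
  \<comment> \<open>97/9 and 86/9 are the sums of the first four terms for \<open>k = 0\<close> and
    \<open>k = 1\<close>, with the factor \<open>exp (- 4)\<close> taken out.\<close>
  from this[of 0] this[of 1] have "97 / 9 * E \<le> ?p 0" "86 / 9 * E \<le> ?p 1"
    unfolding q by (simp_all add: eval_nat_numeral)
  moreover have "exp (1::real) ^ 4 \<le> (272/100) ^ 4"
    using e_less_272 by (intro power_mono) auto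
  then have "inverse ((272/100) ^ 4) \<le> inverse (exp (1::real) ^ 4)"
    by (intro le_imp_inverse_le) auto
  then have "inverse ((272/100) ^ 4) \<le> E"
    by (simp add: E_def exp_minus exp_of_nat_mult[symmetric])
  moreover have "18 / 1000 \<le> inverse ((272/100) ^ 4 :: real)"
    by (simp add: eval_nat_numeral)
  ultimately show ?thesis unfolding p by linarith
qed

lemma skellam_square_prob_ge:
  assumes "n \<ge> 1"
  shows "pmf (skellam_pmf (1/2)) 0 \<le> measure_pmf.prob (skellam_pmf ((real n)\<^sup>2 / 2)) {k. \<bar>k\<bar> < int n}"
proof -
  consider "n = 1" | "n = 2" | "n \<ge> 3" using assms by linarith
  then show ?thesis
  proof cases
    case 1
    have "{k::int. \<bar>k\<bar> < 1} = {0}" by auto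
    with 1 show ?thesis by (simp add: measure_pmf_single)
  next
    case 2
    then show ?thesis using skellam_2_prob_ge pmf_skellam_half_0_le by simp
  next
    case 3
    define s where "s = sqrt (12 * (real n)\<^sup>2 + 1)"
    have pos: "0 < (real n)\<^sup>2 / 2" using 3 by simp
    \<comment> \<open>In terms of \<open>u = n - 3\<close> both squared inequalities compare
      quadratics coefficient by coefficient. The second is tight at \<open>u = 0\<close>: 39349
      against 40000.\<close>
    obtain u where u: "real n = 3 + u" "0 \<le> u" using 3 by (intro that[of "real n - 3"]) auto
    have s: "0 < s" "s\<^sup>2 = 12 * (real n)\<^sup>2 + 1" by (auto simp: s_def intro: add_nonneg_pos)
    have sq: "(2 * real n - 1)\<^sup>2 = 25 + 20 * u + 4 * u\<^sup>2" "(real n)\<^sup>2 = 9 + 6 * u + u\<^sup>2"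
      unfolding u by (simp_all add: power2_eq_square algebra_simps)
    have "(3 * (2 * real n - 1))\<^sup>2 \<le> (2 * s)\<^sup>2"
      unfolding power_mult_distrib s(2) sq using u(2) zero_le_power2[of u] by simp
    then have le: "3 * (2 * real n - 1) \<le> 2 * s"
      by (rule power2_le_imp_le) (use s in simp)
    have "(19 * s)\<^sup>2 \<le> (40 * (2 * real n - 1))\<^sup>2"
      unfolding power_mult_distrib s(2) sq using u(2) zero_le_power2[of u] by simp
    then have "19 * s \<le> 40 * (2 * real n - 1)"
      by (rule power2_le_imp_le) (use 3 in simp)
    then have "19 / 40 \<le> (2 * real n - 1) / s" using s by (simp add: field_simps)
    also have "\<dots> \<le> measure_pmf.prob (skellam_pmf ((real n)\<^sup>2 / 2)) {k. \<bar>k\<bar> < int n}"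
      using discrete_Gauss_inequality[OF symm_unimodal_skellam[OF pos] skellam_moments(2)[OF pos] assms]
        skellam_moments(3)[OF pos] le
      by (simp add: s_def)
    finally show ?thesis using pmf_skellam_half_0_le by linarith
  qed
qed

section \<open>The two infima\<close>

lemma P_lam_eq:
  assumes "0 < lam"
  shows "P_lam lam = measure_pmf.prob (skellam_pmf lam) {y. \<bar>real_of_int y\<bar> \<le> sqrt (2 * lam)}"
    and "P0_lam lam = measure_pmf.prob (skellam_pmf lam) {y. \<bar>real_of_int y\<bar> < sqrt (2 * lam)}"
  unfolding P_lam_def P0_lam_def by (simp_all add: skellam_moments[OF assms])

lemma P0_lam_le_P_lam: "P0_lam lam \<le> P_lam lam"
  unfolding P_lam_def P0_lam_def by (intro measure_pmf.finite_measure_mono) auto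

text \<open>On the integers the open window depends only on the ceiling \<open>n\<close> of its
  radius. The parameter can thus be raised to \<open>n\<^sup>2 / 2\<close> with the window fixed,
  which only lowers the probability.\<close>

lemma P0_lam_ge:
  assumes "0 < lam"
  shows "pmf (skellam_pmf (1/2)) 0 \<le> P0_lam lam"
proof -
  define n where "n = nat \<lceil>sqrt (2 * lam)\<rceil>"
  have "0 < sqrt (2 * lam)" using assms by simp
  then have n: "n \<ge> 1" "sqrt (2 * lam) \<le> real n" "int n = \<lceil>sqrt (2 * lam)\<rceil>"
    unfolding n_def by linarith+
  have "sqrt (2 * lam) ^ 2 \<le> real n ^ 2"
    using n assms by (intro power_mono) auto
  then have le: "lam \<le> (real n)\<^sup>2 / 2" using assms by simp
  have "\<bar>real_of_int y\<bar> < sqrt (2 * lam) \<longleftrightarrow> \<bar>y\<bar> < int n" for y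
    unfolding n(3) by linarith
  then have "P0_lam lam = measure_pmf.prob (skellam_pmf lam) {k. \<bar>k\<bar> < int n}"
    unfolding P_lam_eq(2)[OF assms] by simp
  with skellam_prob_antimono[OF assms le, of n] skellam_square_prob_ge[OF n(1)]
  show ?thesis by simp
qed

lemma P0_lam_half: "P0_lam (1/2) = pmf (skellam_pmf (1/2)) 0"
proof -
  have "{y. \<bar>real_of_int y\<bar> < 1} = {0}" by auto
  then show ?thesis by (simp add: P_lam_eq measure_pmf_single)
qed

text \<open>The sum vanishes when both summands do, and the second one vanishes with probability at
  least \<open>exp (- (2 * m))\<close>, when both of its Poisson variables are 0. This controls the
  limit at 1/2 from the left.\<close>

lemma pmf_skellam_0_add:
  assumes "0 < l" "0 < m"
  shows "pmf (skellam_pmf l) 0 \<le> exp (2 * m) * pmf (skellam_pmf (l + m)) 0"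
proof -
  have "exp (- (2 * m)) = pmf (pair_pmf (poisson_pmf m) (poisson_pmf m)) (0, 0)"
    using assms by (simp add: pmf_pair mult_exp_exp)
  also have "\<dots> = measure_pmf.prob (pair_pmf (poisson_pmf m) (poisson_pmf m)) {(0, 0)}"
    by (simp add: measure_pmf_single)
  also have "\<dots> \<le> pmf (skellam_pmf m) 0"
    unfolding skellam_pmf_def pmf_map by (intro measure_pmf.finite_measure_mono) auto
  finally have "pmf (skellam_pmf l) 0 * exp (- (2 * m)) \<le> pmf (skellam_pmf l) 0 * pmf (skellam_pmf m) 0"
    by (intro mult_left_mono) auto
  also have "\<dots> = measure_pmf.prob (pair_pmf (skellam_pmf l) (skellam_pmf m)) {(0, 0)}"
    by (simp add: measure_pmf_single pmf_pair)
  also have "\<dots> \<le> pmf (skellam_pmf (l + m)) 0"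
    unfolding skellam_add[OF assms, symmetric] pmf_map by (intro measure_pmf.finite_measure_mono) auto
  finally show ?thesis by (simp add: exp_minus field_simps)
qed

lemma P_lam_le:
  assumes "0 < m" "m < 1/2"
  shows "P_lam (1/2 - m) \<le> exp (2 * m) * pmf (skellam_pmf (1/2)) 0"
proof -
  have "{y. \<bar>real_of_int y\<bar> \<le> r} = {0}" if "0 \<le> r" "r < 1" for r
    using that by auto
  from this[of "sqrt (2 * (1/2 - m))"]
  have "{y. \<bar>real_of_int y\<bar> \<le> sqrt (2 * (1/2 - m))} = {0}" using assms by simp
  then have "P_lam (1/2 - m) = pmf (skellam_pmf (1/2 - m)) 0"
    using assms by (simp only: P_lam_eq(1)) (simp add: measure_pmf_single)
  then show ?thesis using pmf_skellam_0_add[of "1/2 - m" m] assms by simp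
qed

lemma INF_P0_lam: "(INF lam\<in>{0<..}. P0_lam lam) = pmf (skellam_pmf (1/2)) 0"
proof (rule antisym)
  have "bdd_below (P0_lam ` {0<..})" using P0_lam_ge by (auto simp: bdd_below_def)
  then show "(INF lam\<in>{0<..}. P0_lam lam) \<le> pmf (skellam_pmf (1/2)) 0"
    unfolding P0_lam_half[symmetric] by (rule cINF_lower) simp
qed (use P0_lam_ge in \<open>auto intro!: cINF_greatest\<close>)

lemma INF_P_lam: "(INF lam\<in>{0<..}. P_lam lam) = pmf (skellam_pmf (1/2)) 0"
proof (rule antisym)
  have ge: "pmf (skellam_pmf (1/2)) 0 \<le> P_lam lam" if "0 < lam" for lam
    using P0_lam_ge[OF that] P0_lam_le_P_lam[of lam] by simp
  then show "pmf (skellam_pmf (1/2)) 0 \<le> (INF lam\<in>{0<..}. P_lam lam)"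
    by (auto intro!: cINF_greatest)
  have bdd: "bdd_below (P_lam ` {0<..})" using ge by (auto simp: bdd_below_def)
  \<comment> \<open>As \<open>m\<close> tends to 0 from above, the upper bound for
    \<open>P_lam (1/2 - m)\<close> tends to the claimed value.\<close>
  have "((\<lambda>m. exp (2 * m) * pmf (skellam_pmf (1/2)) 0) \<longlongrightarrow> exp (2 * 0) * pmf (skellam_pmf (1/2)) 0) (at_right 0)"
    by (intro tendsto_intros)
  moreover have "\<forall>\<^sub>F m in at_right 0. (INF lam\<in>{0<..}. P_lam lam) \<le> exp (2 * m) * pmf (skellam_pmf (1/2)) 0"
    unfolding eventually_at_right_field
  proof (intro exI[of _ "1/2"] conjI allI impI)
    fix m :: real assume m: "0 < m" "m < 1/2"
    have "(INF lam\<in>{0<..}. P_lam lam) \<le> P_lam (1/2 - m)"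
      by (rule cINF_lower[OF bdd]) (use m in simp)
    also note P_lam_le[OF m]
    finally show "(INF lam\<in>{0<..}. P_lam lam) \<le> exp (2 * m) * pmf (skellam_pmf (1/2)) 0" .
  qed simp
  ultimately show "(INF lam\<in>{0<..}. P_lam lam) \<le> pmf (skellam_pmf (1/2)) 0"
    using tendsto_lowerbound by fastforce
qed

section \<open>Infinite divisibility\<close>

text \<open>Independence is read off from joint laws: the coordinate tuple has law \<open>?M\<close>
  itself, which is the product of its marginals \<open>nu\<close>.\<close>

lemma indep_vars_PiM_coordinates:
  assumes "I \<noteq> {}" and "prob_space nu" and "sets nu = sets borel"
  shows "prob_space.indep_vars (PiM I (\<lambda>_. nu)) (\<lambda>_. borel) (\<lambda>i \<omega>. \<omega> i) I"
proof -
  let ?M = "PiM I (\<lambda>_. nu)"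
  interpret M: prob_space ?M using assms(2) by (intro prob_space_PiM)
  have sets: "sets ?M = sets (PiM I (\<lambda>_. borel))" using assms(3) by (intro sets_PiM_cong) auto
  have comp: "distr ?M borel (\<lambda>\<omega>. \<omega> i) = nu" if "i \<in> I" for i
    using distr_PiM_component[of I "\<lambda>_. nu" i] that assms(2,3) distr_cong[of ?M ?M borel nu] by simp
  have rv: "(\<lambda>\<omega>. \<omega> i) \<in> borel_measurable ?M" if "i \<in> I" for i
    using measurable_component_singleton[OF that, of "\<lambda>_. nu"] assms(3) measurable_cong_sets by blast
  have "distr ?M (PiM I (\<lambda>_. borel)) (\<lambda>x. \<lambda>i\<in>I. x i) = distr ?M ?M (\<lambda>x. x)"
    using sets by (intro distr_cong) (auto simp: space_PiM PiE_def extensional_restrict)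
  also have "\<dots> = ?M" by (rule distr_id)
  also have "?M = PiM I (\<lambda>i. distr ?M borel (\<lambda>\<omega>. \<omega> i))"
    using comp by (intro PiM_cong) auto
  finally show ?thesis
    using M.indep_vars_iff_distr_eq_PiM'[OF assms(1), where M' = "\<lambda>_. borel" and X = "\<lambda>i \<omega>. \<omega> i"] rv by simp
qed

lemma inf_divisible_skellam:
  assumes "0 < lam"
  shows "inf_divisible_distr (distr (skellam_pmf lam) borel real_of_int)"
  unfolding inf_divisible_distr_def
proof (intro allI impI)
  fix n :: nat assume n: "n \<ge> 1"
  \<comment> \<open>The n-th convolution root is the Skellam law with parameter
    \<open>lam / n\<close>: the n-th power of its characteristic function restores
    \<open>lam\<close>.\<close>
  define nu where "nu = distr (skellam_pmf (lam / n)) borel real_of_int"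
  let ?M = "PiM {..<n} (\<lambda>_. nu)"
  have nu: "prob_space nu" "sets nu = sets borel"
    unfolding nu_def by (auto intro!: measure_pmf.prob_space_distr)
  interpret M: prob_space ?M using nu(1) by (intro prob_space_PiM)
  have ind: "M.indep_vars (\<lambda>_. borel) (\<lambda>i \<omega>. \<omega> i) {..<n}"
    using n nu by (intro indep_vars_PiM_coordinates) (auto simp: lessThan_empty_iff)
  have rv: "(\<lambda>\<omega>. \<Sum>i<n. \<omega> i) \<in> borel_measurable ?M"
    using ind by (intro borel_measurable_sum) (auto simp: M.indep_vars_def)
  have "distr (skellam_pmf lam) borel real_of_int = distr ?M borel (\<lambda>\<omega>. \<Sum>i<n. \<omega> i)"
  proof (rule Levy_uniqueness)
    show "real_distribution (distr (skellam_pmf lam) borel real_of_int)"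
      by (auto simp: real_distribution_def real_distribution_axioms_def intro!: measure_pmf.prob_space_distr)
    show "real_distribution (distr ?M borel (\<lambda>\<omega>. \<Sum>i<n. \<omega> i))"
      using rv by (auto simp: real_distribution_def real_distribution_axioms_def intro!: M.prob_space_distr)
    show "char (distr (skellam_pmf lam) borel real_of_int) = char (distr ?M borel (\<lambda>\<omega>. \<Sum>i<n. \<omega> i))"
    proof
      fix t
      have comp: "distr ?M borel (\<lambda>\<omega>. \<omega> i) = nu" if "i \<in> {..<n}" for i
        using distr_PiM_component[of "{..<n}" "\<lambda>_. nu" i] that nu distr_cong[of ?M ?M borel nu] by simp
      have "char (distr ?M borel (\<lambda>\<omega>. \<Sum>i<n. \<omega> i)) t = (\<Prod>i<n. char (distr ?M borel (\<lambda>\<omega>. \<omega> i)) t)"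
        by (rule M.char_distr_sum[OF ind])
      also have "\<dots> = char nu t ^ n" using comp by simp
      also have "\<dots> = exp (2 * (lam / n) * (cos t - 1)) ^ n"
        unfolding nu_def using assms n by (subst skellam_char) auto
      also have "exp (2 * (lam / n) * (cos t - 1)) ^ n = exp (2 * lam * (cos t - 1))"
        using n by (simp add: exp_of_nat_mult[symmetric])
      finally show "char (distr (skellam_pmf lam) borel real_of_int) t
          = char (distr ?M borel (\<lambda>\<omega>. \<Sum>i<n. \<omega> i)) t"
        using assms by (simp add: skellam_char)
    qed
  qed
  with nu show "\<exists>nu. prob_space nu \<and> sets nu = sets borel \<and>
      distr (skellam_pmf lam) borel real_of_int = distr (PiM {..<n} (\<lambda>_. nu)) borel (\<lambda>\<omega>. \<Sum>i<n. \<omega> i)"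
    by blast
qed

lemma P_I_le_P_lam:
  assumes "0 < lam"
  shows "P_I \<le> P_lam lam"
proof -
  \<comment> \<open>\<open>class_I\<close> asks for a sample space of reals, so the law is pushed
    forward to the reals and the identity serves as the random variable.\<close>
  let ?M = "measure_pmf (map_pmf real_of_int (skellam_pmf lam))"
  let ?f = "\<lambda>(M, X). measure M {\<omega> \<in> space M. \<bar>X \<omega> - prob_space.expectation M X\<bar>
                                       \<le> sqrt (prob_space.variance M X)}"
  have "distr ?M borel (\<lambda>x. x) = distr (skellam_pmf lam) borel real_of_int"
    unfolding map_pmf_rep_eq by (subst distr_distr) (auto simp: comp_def)
  then have "(?M, \<lambda>x. x) \<in> class_I"
    using inf_divisible_skellam[OF assms] skellam_moments(2)[OF assms]
    by (simp add: class_I_def inf_divisible_rv_def prob_space_measure_pmf integrable_map_pmf_eq)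
  moreover have "bdd_below (?f ` class_I)"
    by (auto intro!: bdd_belowI[of _ 0])
  ultimately have "P_I \<le> ?f (?M, \<lambda>x. x)"
    unfolding P_I_def by (intro cINF_lower)
  also have "\<dots> = P_lam lam"
    by (simp add: P_lam_def vimage_def)
  finally show ?thesis .
qed

theorem theorem4p3:
  shows "(INF lam\<in>{0<..}. P_lam lam) = exp (-1) * (\<Sum>k. 1 / (2 ^ (2 * k) * (fact k)\<^sup>2))
       \<and> (INF lam\<in>{0<..}. P0_lam lam) = exp (-1) * (\<Sum>k. 1 / (2 ^ (2 * k) * (fact k)\<^sup>2))
       \<and> P0_lam (1/2) = exp (-1) * (\<Sum>k. 1 / (2 ^ (2 * k) * (fact k)\<^sup>2))
       \<and> P_I \<le> exp (-1) * (\<Sum>k. 1 / (2 ^ (2 * k) * (fact k)\<^sup>2))"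
proof -
  \<comment> \<open>The whole family is used rather than the parameter 1/2, because the closed
    window of \<open>P_lam (1/2)\<close> also contains 1 and -1.\<close>
  have "P_I \<le> (INF lam\<in>{0<..}. P_lam lam)"
    using P_I_le_P_lam by (intro cINF_greatest) auto
  then show ?thesis
    by (simp only: INF_P_lam INF_P0_lam P0_lam_half pmf_skellam_half_0)
qed

end
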